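(* Let $(\mathbf{A}_N)_{N\ge 1}$ be a sequence of $N\times N$ random matrices with real eigenvalues such that $\mathbf{A}_N\mapsto A\in\mathcal{M}_{\mathrm{alg}}$, and let $\alpha$ be a real scalar. Then: 1. if the limiting distribution of $\mathbf{A}_N$ has no atom at $0$ (and the $\mathbf{A}_N$ are invertible, so that $\mathbf{A}_N^{-1}$ is defined), then $\mathbf{B}_N=\mathbf{A}_N^{-1}\mapsto B\in\mathcal{M}_{\mathrm{alg}}$; 2. $\mathbf{B}_N=\alpha\,\mathbf{A}_N\mapsto B\in\mathcal{M}_{\mathrm{alg}}$; 3. $\mathbf{B}_N=\mathbf{A}_N+\alpha\,\mathbf{I}_N\mapsto B\in\mathcal{M}_{\mathrm{alg}}$.
   Context: For an $N\times N$ matrix $\mathbf{M}$ with real eigenvalues, let $F^{\mathbf{M}}(x)=\frac1N\#\{\text{eigenvalues of }\mathbf{M}\le x\}$ (counted with multiplicity). For a sequence of random matrices $\mathbf{A}_N$ of size $N\times N$ with real eigenvalues, $\mathbf{A}_N\mapsto A$ means that there is a non-random probability distribution function $F^A$ on $\mathbb{R}$ such that, almost surely, $F^{\mathbf{A}_N}(x)\to F^A(x)$ as $N\to\infty$ at every continuity point $x$ of $F^A$; here $A$ is only a symbol naming the limit. The Stieltjes transform of $F^A$ is $m_A(z)=\int\frac{1}{x-z}\,dF^A(x)$ for $z\in\mathbb{C}^+$ (the open upper half plane). The distribution $F^A$ is algebraic if there is a nonzero bivariate polynomial $L(m,z)$ with real coefficients such that $L(m_A(z),z)=0$ for all $z\in\mathbb{C}^+$.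 One writes $\mathbf{A}_N\mapsto A\in\mathcal{M}_{\mathrm{alg}}$ if $\mathbf{A}_N\mapsto A$ and $F^A$ is algebraic. A conclusion $\mathbf{B}_N\mapsto B\in\mathcal{M}_{\mathrm{alg}}$ asserts both that the limiting distribution $F^B$ exists and that it is algebraic. *)

theory Defs
  imports
    "HOL-Probability.Probability"
    "Jordan_Normal_Form.Char_Poly"
    "Jordan_Normal_Form.Gauss_Jordan_Elimination"
begin

text \<open>
  The matrices are complex, so real, Hermitian and non-Hermitian ensembles are all covered.
  Only the members with index \<open>N \<ge> 1\<close> matter; the value at \<open>N = 0\<close> is unconstrained.
  All the matrices of a sequence live on one probability space \<open>P\<close>, as needed for the
  almost sure convergence below.
\<close>

definition random_matrices :: "'w measure \<Rightarrow> (nat \<Rightarrow> 'w \<Rightarrow> complex mat) \<Rightarrow> bool" where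
  "random_matrices P A \<longleftrightarrow>
     (\<forall>N\<ge>1.
        (\<forall>i<N. \<forall>j<N. (\<lambda>w. A N w $$ (i, j)) \<in> borel_measurable P) \<and>
        (\<forall>w\<in>space P. A N w \<in> carrier_mat N N \<and>
                     (\<forall>e. eigenvalue (A N w) e \<longrightarrow> e \<in> \<real>)))"

text \<open>
  The function $F^{M}$. Eigenvalues are counted with algebraic multiplicity, as roots of the
  characteristic polynomial. The real part only converts the type: the definition is used for
  matrices all of whose eigenvalues are real.
\<close>

definition esd :: "complex mat \<Rightarrow> real \<Rightarrow> real" where
  "esd M x = real (size {# e \<in># proots (char_poly M). Re e \<le> x #}) / real (dim_row M)"

text \<open>
  A probability distribution function on the line is represented by the corresponding Borel
  probability measure \<open>\<mu>\<close>, the function itself being \<open>cdf \<mu>\<close>. It is non-random, since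
  \<open>\<mu>\<close> is fixed before the sample point \<open>w\<close>. Convergence at all continuity points of the
  limit is \<open>weak_conv\<close>.
\<close>

definition esd_converges ::
    "'w measure \<Rightarrow> (nat \<Rightarrow> 'w \<Rightarrow> complex mat) \<Rightarrow> real measure \<Rightarrow> bool" where
  "esd_converges P A \<mu> \<longleftrightarrow>
     random_matrices P A \<and> real_distribution \<mu> \<and>
     (AE w in P. weak_conv (\<lambda>N. esd (A N w)) (cdf \<mu>))"

definition stieltjes :: "real measure \<Rightarrow> complex \<Rightarrow> complex" where
  "stieltjes \<mu> z = (\<integral>x. 1 / (complex_of_real x - z) \<partial>\<mu>)"

text \<open>
  A bivariate polynomial $L(m,z) = \sum_j l_j(z)\, m^j$ is encoded as an element of
  \<open>real poly poly\<close>: the outer variable is $m$ and the coefficients $l_j$ are polynomials in $z$.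
\<close>

definition eval_bivariate :: "real poly poly \<Rightarrow> complex \<Rightarrow> complex \<Rightarrow> complex" where
  "eval_bivariate L m z = poly (map_poly (\<lambda>l. poly (map_poly complex_of_real l) z) L) m"

definition algebraic_distribution :: "real measure \<Rightarrow> bool" where
  "algebraic_distribution \<mu> \<longleftrightarrow>
     (\<exists>L. L \<noteq> 0 \<and> (\<forall>z. Im z > 0 \<longrightarrow> eval_bivariate L (stieltjes \<mu> z) z = 0))"

end

theory Submission
  imports Defs
begin

text \<open>
  All three operations move the spectrum by a real function \<open>g\<close>: the roots of the new characteristic
  polynomial, with multiplicity, are the images under \<open>g\<close> of the old ones. This follows from
  \<open>det (u I + v A) = \<Prod> (u + v e)\<close>, the product over the eigenvalues \<open>e\<close> of \<open>A\<close>. Since \<open>g\<close> is continuous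
  almost everywhere for the limit \<open>\<mu>\<close>, the mapping theorem for weak convergence gives convergence to the
  image of \<open>\<mu>\<close> under \<open>g\<close>. Unless \<open>g\<close> is constant, the Stieltjes transform of the image is a rational expression in \<open>z\<close> and in the
  Stieltjes transform of \<open>\<mu>\<close> at a Moebius image of \<open>z\<close>. Substituting and clearing denominators in \<open>L\<close>
  gives an equation for it, which is nontrivial because the substitution is invertible: it takes a point
  where \<open>L\<close> does not vanish as a value. When \<open>g\<close> reverses orientation, the Moebius image lies in the lower
  half plane, and \<open>L(m, z) = 0\<close> holds there too because \<open>L\<close> has real coefficients.
\<close>

section \<open>Weak convergence of image measures, and counting measures of multisets\<close>

lemma weak_conv_m_distr:
  fixes M :: "real measure" and g :: "real \<Rightarrow> real"
  assumes \<nu>: "\<And>n. real_distribution (\<nu> n)" and M: "real_distribution M"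
    and conv: "weak_conv_m \<nu> M"
    and g [measurable]: "g \<in> borel_measurable borel"
    and null: "emeasure M {x. \<not> isCont g x} = 0"
  shows "weak_conv_m (\<lambda>n. distr (\<nu> n) borel g) (distr M borel g)"
proof -
  interpret M: real_distribution M by fact
  interpret \<nu>: real_distribution "\<nu> n" for n by fact
  show ?thesis
  proof (rule integral_bdd_continuous_conv_imp_weak_conv)
    fix f :: "real \<Rightarrow> real"
    assume cont: "\<And>x. isCont f x" and bdd: "\<And>x. \<bar>f x\<bar> \<le> 1"
    have [measurable]: "f \<in> borel_measurable borel"
      using cont by (intro borel_measurable_continuous_onI continuous_at_imp_continuous_on) auto
    \<comment> \<open>Composing with a continuous test function \<open>f\<close> creates no new
      discontinuities. So \<open>f o g\<close> is bounded and continuous almost everywhere for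
      \<open>M\<close>, and its integrals converge; by change of variables these are the integrals
      of \<open>f\<close> against the image measures.\<close>
    have "{x. \<not> isCont (\<lambda>x. f (g x)) x} \<subseteq> {x. \<not> isCont g x}"
      using cont by (auto intro: isCont_o2)
    moreover have "{x. \<not> isCont g x} \<in> sets M"
      by simp
    ultimately have "emeasure M {x. \<not> isCont (\<lambda>x. f (g x)) x} = 0"
      using null emeasure_mono by (metis le_zero_eq)
    then have "(\<lambda>n. \<integral>x. f (g x) \<partial>\<nu> n) \<longlonglongrightarrow> (\<integral>x. f (g x) \<partial>M)"
      using bdd by (intro weak_conv_imp_bdd_ae_continuous_conv[OF \<nu> M conv]) auto
    then show "(\<lambda>n. integral\<^sup>L (distr (\<nu> n) borel g) f) \<longlonglongrightarrow> integral\<^sup>L (distr M borel g) f"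
      by (simp add: integral_distr)
  qed auto
qed

text \<open>Turns the counting quotient in \<open>esd\<close> into a probability, with
  multiplicities as weights.\<close>

lemma prob_pmf_of_multiset:
  assumes "M \<noteq> {#}"
  shows "measure_pmf.prob (pmf_of_multiset M) A = size {#x \<in># M. x \<in> A#} / size M"
proof -
  have "measure_pmf.prob (pmf_of_multiset M) A = measure_pmf.prob (pmf_of_multiset M) (A \<inter> set_mset M)"
    using measure_Int_set_pmf[of "pmf_of_multiset M" A] assms by simp
  also have "\<dots> = (\<Sum>x\<in>A \<inter> set_mset M. count M x / size M)"
    using assms by (subst measure_measure_pmf_finite) auto
  also have "A \<inter> set_mset M = set_mset {#x \<in># M. x \<in> A#}"
    by auto
  also have "(\<Sum>x\<in>set_mset {#x \<in># M. x \<in> A#}. count M x / size M) = size {#x \<in># M. x \<in> A#} / size M"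
    by (simp add: size_multiset_overloaded_eq sum_divide_distrib)
  finally show ?thesis .
qed

section \<open>Spectra of affine images and inverses, with multiplicity\<close>

lemma det_scalar_add_smult:
  fixes A :: "complex mat"
  assumes A: "A \<in> carrier_mat n n"
  shows "det (u \<cdot>\<^sub>m 1\<^sub>m n + v \<cdot>\<^sub>m A) = (\<Prod>e\<in>#proots (char_poly A). u + v * e)"
proof -
  obtain es where es: "char_poly A = (\<Prod>e\<leftarrow>es. [:- e, 1:])" and len: "length es = n"
    using char_poly_factorized[OF A] by blast
  have "0 \<notin> set (map (\<lambda>e. [:- e, 1:]) es)"
    by auto
  from proots_prod_list[OF this] have "proots (char_poly A) = (\<Sum>e\<leftarrow>es. {#e#})"
    by (simp add: es o_def)
  also have "\<dots> = mset es"
    by (induction es) auto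
  finally have roots: "proots (char_poly A) = mset es" .
  show ?thesis
  \<comment> \<open>For nonzero \<open>v\<close> the matrix is \<open>- v\<close> times
    \<open>(- u / v) I - A\<close>, so its determinant is the characteristic polynomial at
    \<open>- u / v\<close>, up to the factor \<open>(- v) ^ n\<close>. That quotient makes no sense
    for \<open>v = 0\<close>, where both sides are \<open>u ^ n\<close>.\<close>
  proof (cases "v = 0")
    case True
    have "u \<cdot>\<^sub>m 1\<^sub>m n + v \<cdot>\<^sub>m A = u \<cdot>\<^sub>m 1\<^sub>m n"
      using A True by (intro eq_matI) auto
    then show ?thesis
      using True len by (simp add: roots)
  next
    case False
    have "det (u \<cdot>\<^sub>m 1\<^sub>m n + v \<cdot>\<^sub>m A) = det ((- v) \<cdot>\<^sub>m (- char_matrix A (- u / v)))"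
      using A False by (intro arg_cong[where f = det] eq_matI) (auto simp: char_matrix_def field_simps)
    also have "\<dots> = (- v) ^ n * poly (char_poly A) (- u / v)"
      using A by (simp add: char_poly_matrix[OF A] char_matrix_def)
    also have "\<dots> = (\<Prod>e\<leftarrow>es. u + v * e)"
      unfolding es len[symmetric] using False
      by (induction es) (auto simp: field_simps)
    finally show ?thesis
      by (simp add: roots flip: prod_mset_prod_list)
  qed
qed

text \<open>Two complex polynomials that agree at every point are equal, and the roots of a product
  of monic linear factors can be read off. It therefore suffices to factor
  \<open>det (x I - B)\<close> for each number \<open>x\<close>.\<close>

lemma proots_char_polyI:
  fixes B :: "complex mat"
  assumes B: "B \<in> carrier_mat n n"
    and det: "\<And>x. det (x \<cdot>\<^sub>m 1\<^sub>m n + (- 1) \<cdot>\<^sub>m B) = (\<Prod>e\<in>#M. x - e)"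
  shows "proots (char_poly B) = M"
proof -
  have "poly (char_poly B) x = poly (\<Prod>e\<in>#M. [:- e, 1:]) x" for x
  proof -
    have "- char_matrix B x = x \<cdot>\<^sub>m 1\<^sub>m n + (- 1) \<cdot>\<^sub>m B"
      using B by (intro eq_matI) (auto simp: char_matrix_def)
    then show ?thesis
      using det by (simp add: char_poly_matrix[OF B] poly_prod_mset image_mset.compositionality o_def)
  qed
  then have "char_poly B = (\<Prod>e\<in>#M. [:- e, 1:])"
    by (intro poly_eq_poly_eq_iff[THEN iffD1] ext)
  moreover have "0 \<notin># image_mset (\<lambda>e. [:- e, 1:]) M"
    by auto
  then have "proots (\<Prod>p\<in>#image_mset (\<lambda>e. [:- e, 1:]) M. p) = (\<Sum>p\<in>#image_mset (\<lambda>e. [:- e, 1:]) M. proots p)"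
    by (rule proots_prod_mset)
  ultimately show ?thesis
    by (simp add: image_mset.compositionality o_def)
qed

text \<open>The characteristic determinant is that of \<open>(x - b) I - a A\<close>, to which the
  factorization of \<open>det (u I + v A)\<close> applies for every \<open>a\<close>, including
  0.\<close>

lemma proots_char_poly_affine:
  fixes A :: "complex mat"
  assumes A: "A \<in> carrier_mat n n"
  shows "proots (char_poly (a \<cdot>\<^sub>m A + b \<cdot>\<^sub>m 1\<^sub>m n)) = image_mset (\<lambda>e. a * e + b) (proots (char_poly A))"
proof (rule proots_char_polyI)
  show "a \<cdot>\<^sub>m A + b \<cdot>\<^sub>m 1\<^sub>m n \<in> carrier_mat n n"
    using A by simp
next
  fix x
  have "det (x \<cdot>\<^sub>m 1\<^sub>m n + (- 1) \<cdot>\<^sub>m (a \<cdot>\<^sub>m A + b \<cdot>\<^sub>m 1\<^sub>m n)) = det ((x - b) \<cdot>\<^sub>m 1\<^sub>m n + (- a) \<cdot>\<^sub>m A)"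
    using A by (intro arg_cong[where f = det] eq_matI) (auto simp: algebra_simps)
  then show "det (x \<cdot>\<^sub>m 1\<^sub>m n + (- 1) \<cdot>\<^sub>m (a \<cdot>\<^sub>m A + b \<cdot>\<^sub>m 1\<^sub>m n))
      = (\<Prod>e\<in>#image_mset (\<lambda>e. a * e + b) (proots (char_poly A)). x - e)"
    by (simp add: det_scalar_add_smult[OF A] image_mset.compositionality o_def algebra_simps)
qed

text \<open>Multiplying by \<open>A\<close> removes the inverse:
  \<open>(x I - B) A = x A - I\<close>, whose determinant is the product of
  \<open>x e - 1 = (x - 1/e) e\<close>. The factors \<open>e\<close> multiply to
  \<open>det A\<close>, which is nonzero and cancels.\<close>

lemma proots_char_poly_inverse:
  fixes A :: "complex mat"
  assumes A: "A \<in> carrier_mat n n" and B: "B \<in> carrier_mat n n"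
    and AB: "A * B = 1\<^sub>m n" and BA: "B * A = 1\<^sub>m n"
  shows "proots (char_poly B) = image_mset inverse (proots (char_poly A))"
proof (rule proots_char_polyI[OF B])
  fix x
  define E where "E = proots (char_poly A)"
  have "0 \<cdot>\<^sub>m 1\<^sub>m n + 1 \<cdot>\<^sub>m A = A"
    using A by (intro eq_matI) auto
  then have detA: "det A = (\<Prod>e\<in>#E. e)"
    using det_scalar_add_smult[OF A, of 0 1] by (simp add: E_def)
  have "det A * det B = 1"
    using det_mult[OF A B] AB by simp
  then have nz: "(\<Prod>e\<in>#E. e) \<noteq> 0"
    using detA by (metis mult_zero_left zero_neq_one)
  then have E0: "e \<noteq> 0" if "e \<in># E" for e
    using that by auto
  have "(x \<cdot>\<^sub>m 1\<^sub>m n + (- 1) \<cdot>\<^sub>m B) * A = x \<cdot>\<^sub>m A + (- 1) \<cdot>\<^sub>m (B * A)"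
    using A B by (subst add_mult_distrib_mat[of _ n n]) auto
  also have "\<dots> = (- 1) \<cdot>\<^sub>m 1\<^sub>m n + x \<cdot>\<^sub>m A"
    using A BA by (intro eq_matI) auto
  finally have "det (x \<cdot>\<^sub>m 1\<^sub>m n + (- 1) \<cdot>\<^sub>m B) * det A = det ((- 1) \<cdot>\<^sub>m 1\<^sub>m n + x \<cdot>\<^sub>m A)"
    using A B by (subst det_mult[symmetric, of _ n]) auto
  also have "\<dots> = (\<Prod>e\<in>#E. - 1 + x * e)"
    unfolding det_scalar_add_smult[OF A] E_def ..
  also have "\<dots> = (\<Prod>e\<in>#E. (x - inverse e) * e)"
    by (intro arg_cong[where f = prod_mset] image_mset_cong) (auto dest!: E0 simp: field_simps)
  also have "\<dots> = (\<Prod>e\<in>#E. x - inverse e) * (\<Prod>e\<in>#E. e)"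
    by (rule prod_mset.distrib)
  finally show "det (x \<cdot>\<^sub>m 1\<^sub>m n + (- 1) \<cdot>\<^sub>m B) = (\<Prod>e\<in>#image_mset inverse (proots (char_poly A)). x - e)"
    using nz by (simp add: detA image_mset.compositionality o_def flip: E_def)
qed

section \<open>Measurability of the entries of an inverse matrix\<close>

lemma borel_measurable_det:
  fixes X :: "'w \<Rightarrow> complex mat"
  assumes X: "\<And>w. w \<in> space M \<Longrightarrow> X w \<in> carrier_mat n n"
    and [measurable]: "\<And>i j. i < n \<Longrightarrow> j < n \<Longrightarrow> (\<lambda>w. X w $$ (i, j)) \<in> borel_measurable M"
  shows "(\<lambda>w. det (X w)) \<in> borel_measurable M"
proof -
  have "(\<lambda>w. \<Sum>p | p permutes {0..<n}. signof p * (\<Prod>i = 0..<n. X w $$ (i, p i))) \<in> borel_measurable M"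
  proof (intro borel_measurable_sum borel_measurable_times borel_measurable_prod)
    fix p i assume "p \<in> {p. p permutes {0..<n}}" "i \<in> {0..<n}"
    then have "i < n" "p i < n"
      using permutes_in_image[of p "{0..<n}" i] by auto
    then show "(\<lambda>w. X w $$ (i, p i)) \<in> borel_measurable M"
      by measurable
  qed auto
  then show ?thesis
    using X by (subst measurable_cong[where g = "\<lambda>w. \<Sum>p | p permutes {0..<n}. signof p * (\<Prod>i = 0..<n. X w $$ (i, p i))"])
      (auto simp: det_def')
qed

text \<open>Cramer's rule, from the adjugate identity multiplied by \<open>B\<close>. It expresses
  the entries of the inverse by determinants, so their measurability does not depend on how the
  inverse is computed.\<close>

lemma inverse_mat_entry:
  fixes A :: "'a :: field mat"
  assumes A: "A \<in> carrier_mat n n" and B: "B \<in> carrier_mat n n" and AB: "A * B = 1\<^sub>m n"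
    and ij: "i < n" "j < n"
  shows "B $$ (i, j) = (- 1) ^ (j + i) * det (mat_delete A j i) / det A"
proof -
  note adj = adj_mat[OF A]
  have "adj_mat A = adj_mat A * (A * B)"
    using adj(1) AB by simp
  also have "\<dots> = (adj_mat A * A) * B"
    using adj(1) A B by (simp add: assoc_mult_mat)
  also have "\<dots> = det A \<cdot>\<^sub>m B"
    using B by (simp add: adj(3) mult_smult_assoc_mat[of _ n n])
  finally have "adj_mat A $$ (i, j) = det A * B $$ (i, j)"
    using B ij by simp
  moreover have "det A * det B = 1"
    using det_mult[OF A B] AB by simp
  then have "det A \<noteq> 0"
    by auto
  ultimately show ?thesis
    using A ij by (simp add: adj_mat_def cofactor_def field_simps)
qed

lemma borel_measurable_inverse_mat_entry:
  fixes X Y :: "'w \<Rightarrow> complex mat"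
  assumes X: "\<And>w. w \<in> space M \<Longrightarrow> X w \<in> carrier_mat n n"
    and Y: "\<And>w. w \<in> space M \<Longrightarrow> Y w \<in> carrier_mat n n"
    and XY: "\<And>w. w \<in> space M \<Longrightarrow> X w * Y w = 1\<^sub>m n"
    and meas: "\<And>i j. i < n \<Longrightarrow> j < n \<Longrightarrow> (\<lambda>w. X w $$ (i, j)) \<in> borel_measurable M"
    and ij: "i < n" "j < n"
  shows "(\<lambda>w. Y w $$ (i, j)) \<in> borel_measurable M"
proof -
  have [measurable]: "(\<lambda>w. det (X w)) \<in> borel_measurable M"
    using X meas by (rule borel_measurable_det)
  have [measurable]: "(\<lambda>w. det (mat_delete (X w) j i)) \<in> borel_measurable M"
  proof (rule borel_measurable_det)
    show "mat_delete (X w) j i \<in> carrier_mat (n - 1) (n - 1)" if "w \<in> space M" for w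
      using X[OF that] by (rule mat_delete_carrier)
    fix k l assume kl: "k < n - 1" "l < n - 1"
    show "(\<lambda>w. mat_delete (X w) j i $$ (k, l)) \<in> borel_measurable M"
      using X kl
      by (subst measurable_cong[where g = "\<lambda>w. X w $$ (if k < j then k else Suc k, if l < i then l else Suc l)"])
        (auto simp: mat_delete_def X[THEN carrier_matD(1)] X[THEN carrier_matD(2)] intro!: meas)
  qed
  have "(\<lambda>w. (- 1) ^ (j + i) * det (mat_delete (X w) j i) / det (X w)) \<in> borel_measurable M"
    by measurable
  then show ?thesis
    using inverse_mat_entry[OF X Y XY ij] by (subst measurable_cong) auto
qed

section \<open>Evaluating bivariate polynomials and substituting into them\<close>

abbreviation cpoly :: "real poly \<Rightarrow> complex \<Rightarrow> complex" where
  "cpoly p z \<equiv> poly (map_poly complex_of_real p) z"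

text \<open>Used once for the variable z and a second time on top of that for m, so that evaluation
  can be pushed through sums, products and powers.\<close>

lemma comm_ring_hom_poly_map_poly:
  fixes f :: "'a :: comm_ring_1 \<Rightarrow> 'b :: comm_ring_1"
  assumes "comm_ring_hom f"
  shows "comm_ring_hom (\<lambda>p. poly (map_poly f p) x)"
proof -
  interpret f: comm_ring_hom f by fact
  interpret F: map_poly_comm_ring_hom f ..
  show ?thesis
    by unfold_locales (simp_all add: F.hom_add F.hom_mult)
qed

lemma comm_ring_hom_cpoly: "comm_ring_hom (\<lambda>p. cpoly p z)"
  by (intro comm_ring_hom_poly_map_poly of_real_hom.comm_ring_hom_axioms)

lemma comm_ring_hom_eval_bivariate: "comm_ring_hom (\<lambda>L. eval_bivariate L m z)"
  unfolding eval_bivariate_def by (intro comm_ring_hom_poly_map_poly of_real_hom.comm_ring_hom_axioms)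

lemma cpoly_pCons [simp]: "cpoly (pCons a p) z = of_real a + z * cpoly p z"
  by (cases "a = 0 \<and> p = 0") (auto simp: map_poly_pCons)

lemma eval_bivariate_0 [simp]: "eval_bivariate 0 m z = 0"
  by (simp add: eval_bivariate_def)

lemma eval_bivariate_pCons [simp]:
  "eval_bivariate (pCons l L) m z = cpoly l z + m * eval_bivariate L m z"
  by (cases "l = 0 \<and> L = 0") (auto simp: eval_bivariate_def map_poly_pCons)

lemma poly_eq_sum_atMost:
  fixes p :: "'a :: comm_semiring_1 poly"
  assumes "degree p \<le> n"
  shows "poly p x = (\<Sum>i\<le>n. coeff p i * x ^ i)"
  unfolding poly_altdef using assms
  by (intro sum.mono_neutral_left) (auto simp: coeff_eq_0)

text \<open>One bound \<open>k\<close> on the z-degree of all coefficients allows denominators to be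
  cleared later by a single power.\<close>

lemma eval_bivariate_eq_sum:
  assumes k: "\<And>j. j \<le> degree L \<Longrightarrow> degree (coeff L j) \<le> k"
  shows "eval_bivariate L m z
    = (\<Sum>j\<le>degree L. (\<Sum>i\<le>k. of_real (coeff (coeff L j) i) * z ^ i) * m ^ j)"
proof -
  have "cpoly (coeff L j) z = (\<Sum>i\<le>k. of_real (coeff (coeff L j) i) * z ^ i)" if "j \<le> degree L" for j
  proof -
    have "degree (map_poly complex_of_real (coeff L j)) \<le> k"
      using degree_map_poly_le k[OF that] by (rule order_trans)
    then show ?thesis
      by (simp add: poly_eq_sum_atMost[of _ k] coeff_map_poly)
  qed
  then show ?thesis
    unfolding eval_bivariate_def
    by (subst poly_eq_sum_atMost[OF degree_map_poly_le]) (simp add: coeff_map_poly)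
qed

lemma degree_coeff_bound:
  obtains k where "\<And>j. j \<le> degree L \<Longrightarrow> degree (coeff L j) \<le> k"
proof
  show "degree (coeff L j) \<le> Max ((\<lambda>j. degree (coeff L j)) ` {..degree L})" if "j \<le> degree L" for j
    using that by (intro Max_ge) auto
qed

lemma eval_bivariate_cnj: "eval_bivariate L (cnj m) (cnj z) = cnj (eval_bivariate L m z)"
proof -
  obtain k where k: "\<And>j. j \<le> degree L \<Longrightarrow> degree (coeff L j) \<le> k"
    using degree_coeff_bound[of L] by blast
  show ?thesis
    by (simp add: eval_bivariate_eq_sum[OF k])
qed

text \<open>Homogenization: with \<open>k\<close> bounding all z-degrees, replacing z by p/q and
  multiplying by q^k turns z^i into p^i q^(k-i), which is again a polynomial. The variable m is
  replaced by the polynomial \<open>S\<close>, which produces no denominators.\<close>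

lemma eval_bivariate_substitute:
  obtains L' k where "\<And>m z. cpoly q z \<noteq> 0 \<Longrightarrow>
    eval_bivariate L' m z = cpoly q z ^ k * eval_bivariate L (eval_bivariate S m z) (cpoly p z / cpoly q z)"
proof -
  obtain k where k: "\<And>j. j \<le> degree L \<Longrightarrow> degree (coeff L j) \<le> k"
    using degree_coeff_bound[of L] by blast
  define c where "c j i = coeff (coeff L j) i" for j i
  define L' where "L' = (\<Sum>j\<le>degree L. [:\<Sum>i\<le>k. [:c j i:] * (p ^ i * q ^ (k - i)):] * S ^ j)"
  show thesis
  proof (rule that)
    fix m z assume q: "cpoly q z \<noteq> 0"
    interpret P: comm_ring_hom "\<lambda>p. cpoly p z" by (rule comm_ring_hom_cpoly)
    interpret E: comm_ring_hom "\<lambda>L. eval_bivariate L m z" by (rule comm_ring_hom_eval_bivariate)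
    have homogenize: "(\<Sum>i\<le>k. of_real (c j i) * (cpoly p z ^ i * cpoly q z ^ (k - i)))
        = cpoly q z ^ k * (\<Sum>i\<le>k. of_real (c j i) * (cpoly p z / cpoly q z) ^ i)" for j
      unfolding sum_distrib_left using q by (intro sum.cong refl) (simp add: power_diff power_divide)
    have "eval_bivariate L' m z
        = (\<Sum>j\<le>degree L. (\<Sum>i\<le>k. of_real (c j i) * (cpoly p z ^ i * cpoly q z ^ (k - i))) * eval_bivariate S m z ^ j)"
      unfolding L'_def by (simp add: P.hom_sum P.hom_mult P.hom_power E.hom_sum E.hom_mult E.hom_power del: mult_pCons_left mult_pCons_right)
    also have "\<dots> = cpoly q z ^ k * eval_bivariate L (eval_bivariate S m z) (cpoly p z / cpoly q z)"
      unfolding homogenize by (simp add: eval_bivariate_eq_sum[OF k] c_def sum_distrib_left[of _ _ "{..degree L}"] mult.assoc)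
    finally show "eval_bivariate L' m z = \<dots>" .
  qed
qed

lemma infinite_upper_half_plane: "infinite {z. Im z > 0}"
proof
  assume "finite {z. Im z > 0}"
  moreover have "inj (\<lambda>n. Complex 0 (real (Suc n)))"
    by (auto intro!: injI)
  moreover have "range (\<lambda>n. Complex 0 (real (Suc n))) \<subseteq> {z. Im z > 0}"
    by auto
  ultimately show False
    using finite_subset range_inj_infinite by blast
qed

text \<open>The leading coefficient in m has finitely many roots z, so some z in the upper half
  plane avoids them; at that z, \<open>L\<close> is a nonzero polynomial in m. The half plane
  matters because the substitutions below are only assumed to reach points over it.\<close>

lemma eval_bivariate_nonzero:
  assumes "L \<noteq> 0"
  obtains m z where "Im z > 0" "eval_bivariate L m z \<noteq> 0"
proof -
  have "map_poly complex_of_real (lead_coeff L) \<noteq> 0"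
    using assms by (simp add: map_poly_eq_0_iff)
  then have "finite {z. cpoly (lead_coeff L) z = 0}"
    by (rule poly_roots_finite)
  then have "\<not> {z. Im z > 0} \<subseteq> {z. cpoly (lead_coeff L) z = 0}"
    using infinite_upper_half_plane finite_subset by auto
  then obtain z where z: "Im z > 0" "cpoly (lead_coeff L) z \<noteq> 0"
    by auto
  let ?p = "map_poly (\<lambda>l. cpoly l z) L"
  have "coeff ?p (degree L) \<noteq> 0"
    using z by (simp add: coeff_map_poly)
  then have "?p \<noteq> 0"
    by auto
  then obtain m where "poly ?p m \<noteq> 0"
    using poly_all_0_iff_0 by blast
  then show thesis
    using z that by (simp add: eval_bivariate_def)
qed

section \<open>Stieltjes transforms and algebraicity of image distributions\<close>

lemma (in real_distribution) integrable_stieltjes: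
  assumes "Im z \<noteq> 0"
  shows "integrable M (\<lambda>x. 1 / (complex_of_real x - z))"
proof (rule integrable_const_bound[where B = "1 / \<bar>Im z\<bar>"])
  have "\<bar>Im z\<bar> \<le> norm (complex_of_real x - z)" for x
    using abs_Im_le_cmod[of "complex_of_real x - z"] by simp
  then show "AE x in M. norm (1 / (complex_of_real x - z)) \<le> 1 / \<bar>Im z\<bar>"
    using assms by (intro always_eventually allI) (simp add: norm_divide frac_le)
qed measurable

lemma stieltjes_cnj: "stieltjes \<mu> (cnj z) = cnj (stieltjes \<mu> z)"
  unfolding stieltjes_def by (subst Bochner_Integration.integral_cnj[symmetric]) simp

lemma stieltjes_distr:
  assumes "real_distribution \<mu>" and [measurable]: "g \<in> borel_measurable borel"
  shows "stieltjes (distr \<mu> borel g) z = (\<integral>x. 1 / (complex_of_real (g x) - z) \<partial>\<mu>)"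
proof -
  interpret real_distribution \<mu> by fact
  show ?thesis
    unfolding stieltjes_def by (subst integral_distr) auto
qed

text \<open>The assumption \<open>sub\<close> makes the substituted polynomial vanish on the
  transform of \<nu>; it asks only for a nonreal argument, so that orientation-reversing maps are
  allowed. The assumption \<open>surj\<close> keeps that polynomial nonzero, by pulling back a point
  where \<open>L\<close> does not vanish. The point pulled back may have any z with nonzero
  denominator, since it only witnesses a nonzero polynomial.\<close>

lemma algebraic_distribution_substitute:
  assumes alg: "algebraic_distribution \<mu>"
    and sub: "\<And>z. Im z > 0 \<Longrightarrow> cpoly q z \<noteq> 0 \<and> Im (cpoly p z / cpoly q z) \<noteq> 0 \<and>
       eval_bivariate S (stieltjes \<nu> z) z = stieltjes \<mu> (cpoly p z / cpoly q z)"
    and surj: "\<And>m w. Im w > 0 \<Longrightarrow>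
       \<exists>m' z. cpoly q z \<noteq> 0 \<and> cpoly p z / cpoly q z = w \<and> eval_bivariate S m' z = m"
  shows "algebraic_distribution \<nu>"
proof -
  obtain L where "L \<noteq> 0" and L: "\<And>z. Im z > 0 \<Longrightarrow> eval_bivariate L (stieltjes \<mu> z) z = 0"
    using alg unfolding algebraic_distribution_def by blast
  obtain L' k where L': "\<And>m z. cpoly q z \<noteq> 0 \<Longrightarrow> eval_bivariate L' m z
      = cpoly q z ^ k * eval_bivariate L (eval_bivariate S m z) (cpoly p z / cpoly q z)"
    using eval_bivariate_substitute[of q L S p] by blast
  have nonreal: "eval_bivariate L (stieltjes \<mu> z) z = 0" if "Im z \<noteq> 0" for z
  proof (cases "Im z > 0")
    case False
    then have "eval_bivariate L (stieltjes \<mu> (cnj z)) (cnj z) = 0"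
      using that by (intro L) auto
    then show ?thesis
      by (simp add: stieltjes_cnj eval_bivariate_cnj)
  qed (rule L)
  obtain m w where "Im w > 0" "eval_bivariate L m w \<noteq> 0"
    using \<open>L \<noteq> 0\<close> by (rule eval_bivariate_nonzero)
  moreover obtain m' z where "cpoly q z \<noteq> 0" "cpoly p z / cpoly q z = w" "eval_bivariate S m' z = m"
    using surj[OF \<open>Im w > 0\<close>] by blast
  ultimately have "eval_bivariate L' m' z \<noteq> 0"
    by (simp add: L')
  then have "L' \<noteq> 0"
    by auto
  moreover have "eval_bivariate L' (stieltjes \<nu> z) z = 0" if "Im z > 0" for z
    using sub[OF that] by (simp add: L' nonreal)
  ultimately show ?thesis
    unfolding algebraic_distribution_def by blast
qed

lemma algebraic_distribution_affine:
  assumes \<mu>: "real_distribution \<mu>" and alg: "algebraic_distribution \<mu>"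
  shows "algebraic_distribution (distr \<mu> borel (\<lambda>x. a * x + b))"
proof (cases "a = 0")
  case True
  interpret real_distribution \<mu> by fact
  \<comment> \<open>The image is the point mass at \<open>b\<close>, with transform 1/(b - z); the
    polynomial is (b - z) m - 1.\<close>
  have "eval_bivariate [:[:- 1:], [:b, - 1:]:] (stieltjes (distr \<mu> borel (\<lambda>x. a * x + b)) z) z = 0"
    if "Im z > 0" for z
  proof -
    have "z \<noteq> of_real b"
      using that by auto
    moreover have "stieltjes (distr \<mu> borel (\<lambda>x. a * x + b)) z = 1 / (of_real b - z)"
      using True by (subst stieltjes_distr[OF \<mu>]) (simp_all add: prob_space[simplified])
    ultimately show ?thesis
      by (simp add: field_simps)
  qed
  then show ?thesis
    unfolding algebraic_distribution_def by (intro exI[of _ "[:[:- 1:], [:b, - 1:]:]"]) simp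
next
  case False
  \<comment> \<open>With w = (z - b)/a one has 1/(a x + b - z) = (1/a) / (x - w), so the transform
    of \<mu> at w is \<open>a\<close> times the new transform. This gives \<open>p\<close> and
    \<open>S\<close>; for negative \<open>a\<close> the point w lies in the lower half
    plane.\<close>
  show ?thesis
  proof (rule algebraic_distribution_substitute[where p = "[:- b / a, 1 / a:]" and q = 1 and S = "[:0, [:a:]:]", OF alg])
    fix z assume "Im z > 0"
    let ?D = "distr \<mu> borel (\<lambda>x. a * x + b)" and ?w = "(z - of_real b) / of_real a"
    have eq: "1 / (complex_of_real (a * x + b) - z) = 1 / of_real a * (1 / (of_real x - ?w))" for x
    proof -
      have "of_real a * ?w = z - of_real b"
        using False by simp
      then have "complex_of_real (a * x + b) - z = of_real a * (of_real x - ?w)"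
        by (simp only: right_diff_distrib) simp
      then show ?thesis
        by simp
    qed
    have "stieltjes ?D z = (\<integral>x. 1 / (complex_of_real (a * x + b) - z) \<partial>\<mu>)"
      by (rule stieltjes_distr[OF \<mu>]) measurable
    also have "\<dots> = 1 / of_real a * stieltjes \<mu> ?w"
      unfolding eq stieltjes_def by (rule integral_mult_right_zero)
    finally have "of_real a * stieltjes ?D z = stieltjes \<mu> ?w"
      using False by simp
    moreover have "cpoly [:- b / a, 1 / a:] z / cpoly 1 z = ?w"
      using False by (simp add: diff_divide_distrib)
    moreover have "Im ?w \<noteq> 0"
      using False \<open>Im z > 0\<close> by simp
    ultimately show "cpoly 1 z \<noteq> 0 \<and> Im (cpoly [:- b / a, 1 / a:] z / cpoly 1 z) \<noteq> 0 \<and>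
       eval_bivariate [:0, [:a:]:] (stieltjes (distr \<mu> borel (\<lambda>x. a * x + b)) z) z
       = stieltjes \<mu> (cpoly [:- b / a, 1 / a:] z / cpoly 1 z)"
      by (simp add: mult.commute)
  next
    fix m w :: complex
    show "\<exists>m' z. cpoly 1 z \<noteq> 0 \<and> cpoly [:- b / a, 1 / a:] z / cpoly 1 z = w \<and> eval_bivariate [:0, [:a:]:] m' z = m"
      using False by (intro exI[of _ "m / of_real a"] exI[of _ "of_real a * w + of_real b"]) (simp add: field_simps)
  qed
qed

lemma algebraic_distribution_inverse:
  assumes \<mu>: "real_distribution \<mu>" and alg: "algebraic_distribution \<mu>" and atom: "measure \<mu> {0} = 0"
  shows "algebraic_distribution (distr \<mu> borel inverse)"
proof -
  have eval: "eval_bivariate [:[:0, -1:], [:0, 0, -1:]:] m z = - z - z\<^sup>2 * m" for m z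
    by (simp add: power2_eq_square algebra_simps)
  \<comment> \<open>The choice comes from 1/(x - 1/z) = - z - z^2 / (1/x - z), integrated over
    \<mu>: the Moebius map is 1/z and \<open>S\<close> is - z - z^2 m.\<close>
  show ?thesis
  proof (rule algebraic_distribution_substitute[where p = 1 and q = "[:0, 1:]" and S = "[:[:0, -1:], [:0, 0, -1:]:]", OF alg])
    fix z assume z: "Im z > 0"
    interpret real_distribution \<mu> by fact
    interpret \<nu>: real_distribution "distr \<mu> borel inverse" by simp
    have z0: "z \<noteq> 0"
      using z by auto
    \<comment> \<open>The identity fails at x = 0, where \<open>inverse 0 = 0\<close> makes the
      right side 0 and the left side - z. The absence of an atom discards this point.\<close>
    have "AE x in \<mu>. x \<noteq> 0"
      using atom by (intro AE_I[where N = "{0}"]) (auto simp: emeasure_eq_measure)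
    then have ae: "AE x in \<mu>. 1 / (of_real x - 1 / z) = - z - z\<^sup>2 * (1 / (of_real (inverse x) - z))"
    proof eventually_elim
      case (elim x)
      have "z * of_real x \<noteq> 1"
      proof
        assume "z * of_real x = 1"
        then have "Im (z * of_real x) = 0" by simp
        then show False using z elim by simp
      qed
      then have "of_real x - 1 / z \<noteq> 0" "of_real (inverse x) - z \<noteq> 0"
        using z0 elim by (auto simp: field_simps)
      then show ?case
        using z0 elim by (simp add: divide_simps) (simp add: algebra_simps power2_eq_square)
    qed
    have \<nu>: "stieltjes (distr \<mu> borel inverse) z = (\<integral>x. 1 / (complex_of_real (inverse x) - z) \<partial>\<mu>)"
      by (rule stieltjes_distr[OF \<mu>]) measurable
    have int: "integrable \<mu> (\<lambda>x. 1 / (complex_of_real (inverse x) - z))"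
      using z by (intro integrable_distr[OF _ \<nu>.integrable_stieltjes]) auto
    have "stieltjes \<mu> (1 / z) = (\<integral>x. - z - z\<^sup>2 * (1 / (complex_of_real (inverse x) - z)) \<partial>\<mu>)"
      unfolding stieltjes_def by (rule integral_cong_AE[OF _ _ ae]) measurable
    also have "\<dots> = (\<integral>x. - z \<partial>\<mu>) - (\<integral>x. z\<^sup>2 * (1 / (complex_of_real (inverse x) - z)) \<partial>\<mu>)"
      by (intro Bochner_Integration.integral_diff integrable_mult_right int) simp
    also have "\<dots> = - z - z\<^sup>2 * stieltjes (distr \<mu> borel inverse) z"
      unfolding \<nu> by (simp only: integral_mult_right_zero) (simp add: prob_space[simplified])
    finally have "stieltjes \<mu> (1 / z) = - z - z\<^sup>2 * stieltjes (distr \<mu> borel inverse) z" .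
    moreover have "Im (1 / z) \<noteq> 0"
      using z z0 by (simp add: Im_divide complex_eq_iff)
    ultimately show "cpoly [:0, 1:] z \<noteq> 0 \<and> Im (cpoly 1 z / cpoly [:0, 1:] z) \<noteq> 0 \<and>
        eval_bivariate [:[:0, -1:], [:0, 0, -1:]:] (stieltjes (distr \<mu> borel inverse) z) z
        = stieltjes \<mu> (cpoly 1 z / cpoly [:0, 1:] z)"
      using z0 by (simp add: eval del: eval_bivariate_pCons)
  next
    fix m w :: complex
    assume "Im w > 0"
    then have "w \<noteq> 0"
      by auto
    then show "\<exists>m' z. cpoly [:0, 1:] z \<noteq> 0 \<and> cpoly 1 z / cpoly [:0, 1:] z = w \<and>
        eval_bivariate [:[:0, -1:], [:0, 0, -1:]:] m' z = m"
      \<comment> \<open>Obtained by solving m = - z - z^2 m' for m' at z = 1/w.\<close>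
      by (intro exI[of _ "- (m + 1 / w) * w\<^sup>2"] exI[of _ "1 / w"]) (simp add: eval power_divide del: eval_bivariate_pCons)
  qed
qed

section \<open>Convergence of the empirical spectral distributions\<close>

lemma size_proots_char_poly:
  fixes A :: "complex mat"
  assumes "A \<in> carrier_mat n n"
  shows "size (proots (char_poly A)) = n"
  using degree_monic_char_poly[OF assms] by (simp add: size_proots_complex)

lemma in_proots_char_poly_iff:
  fixes A :: "complex mat"
  assumes "A \<in> carrier_mat n n"
  shows "e \<in># proots (char_poly A) \<longleftrightarrow> eigenvalue A e"
proof -
  have "char_poly A \<noteq> 0"
    using degree_monic_char_poly[OF assms] by auto
  then show ?thesis
    by (simp add: eigenvalue_root_char_poly[OF assms])
qed

text \<open>Realizes \<open>esd\<close> as the distribution function of a measure, so that the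
  mapping theorem applies. Going through a \<open>pmf\<close> makes it a probability measure for
  every matrix, without side conditions.\<close>

definition spectral_measure :: "complex mat \<Rightarrow> real measure" where
  "spectral_measure A = distr (measure_pmf (pmf_of_multiset (proots (char_poly A)))) borel Re"

lemma real_distribution_spectral_measure: "real_distribution (spectral_measure A)"
  unfolding spectral_measure_def by (intro prob_space.real_distribution_distr measure_pmf.prob_space_axioms) simp

lemma cdf_distr_spectral_measure:
  assumes A: "A \<in> carrier_mat n n" and n: "n \<ge> 1" and [measurable]: "g \<in> borel_measurable borel"
  shows "cdf (distr (spectral_measure A) borel g) x
    = size {#e \<in># proots (char_poly A). g (Re e) \<le> x#} / n"
proof -
  have [measurable]: "Re \<in> measurable (measure_pmf p) borel" for p
    by simp
  have "size (proots (char_poly A)) = n"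
    using A by (rule size_proots_char_poly)
  moreover from this have "proots (char_poly A) \<noteq> {#}"
    using n by auto
  ultimately show ?thesis
    unfolding cdf_def spectral_measure_def
    by (simp add: distr_distr measure_distr prob_pmf_of_multiset o_def)
qed

text \<open>The roots move by a complex map \<open>h\<close>, while the limit moves by the real map
  \<open>g\<close>. All roots of the original matrices are real, so the two agree on them; hence
  \<open>esd\<close> of \<open>B\<close> is the distribution function of the image under
  \<open>g\<close> of the spectral measure of \<open>A\<close>.\<close>

lemma esd_converges_transform:
  assumes conv: "esd_converges P A \<mu>"
    and g [measurable]: "g \<in> borel_measurable borel"
    and null: "emeasure \<mu> {x. \<not> isCont g x} = 0"
    and carrier: "\<And>N w. N \<ge> 1 \<Longrightarrow> w \<in> space P \<Longrightarrow> B N w \<in> carrier_mat N N"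
    and meas: "\<And>N i j. N \<ge> 1 \<Longrightarrow> i < N \<Longrightarrow> j < N \<Longrightarrow> (\<lambda>w. B N w $$ (i, j)) \<in> borel_measurable P"
    and roots: "\<And>N w. N \<ge> 1 \<Longrightarrow> w \<in> space P \<Longrightarrow>
      proots (char_poly (B N w)) = image_mset h (proots (char_poly (A N w)))"
    and h: "\<And>x. h (complex_of_real x) = complex_of_real (g x)"
  shows "esd_converges P B (distr \<mu> borel g)"
proof -
  from conv have A: "A N w \<in> carrier_mat N N" and real: "\<And>e. eigenvalue (A N w) e \<Longrightarrow> e \<in> \<real>"
    if "N \<ge> 1" "w \<in> space P" for N w
    using that unfolding esd_converges_def random_matrices_def by auto
  interpret \<mu>: real_distribution \<mu>
    using conv by (simp add: esd_converges_def)
  have h_root: "h e = of_real (g (Re e))" if "N \<ge> 1" "w \<in> space P" "e \<in># proots (char_poly (A N w))" for N w e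
    using that real[of N w e] h[of "Re e"] by (simp add: in_proots_char_poly_iff[OF A])
  have "random_matrices P B"
    unfolding random_matrices_def
  proof (intro allI impI conjI ballI)
    fix N w e assume Nw: "1 \<le> N" "w \<in> space P" and "eigenvalue (B N w) e"
    then have "e \<in># image_mset h (proots (char_poly (A N w)))"
      by (simp add: roots flip: in_proots_char_poly_iff[OF carrier])
    then show "e \<in> \<real>"
      using h_root[OF Nw] by auto
  qed (use carrier meas in auto)
  moreover have "AE w in P. weak_conv (\<lambda>N. esd (B N w)) (cdf (distr \<mu> borel g))"
  proof -
    have "AE w in P. weak_conv (\<lambda>N. esd (A N w)) (cdf \<mu>)"
      using conv by (simp add: esd_converges_def)
    moreover have "AE w in P. w \<in> space P"
      by simp
    ultimately show ?thesis
    proof eventually_elim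
      case (elim w)
      \<comment> \<open>The shift skips the unconstrained member N = 0; limits are carried across it
        in both directions below.\<close>
      define \<nu> where "\<nu> n = spectral_measure (A (Suc n) w)" for n
      have esdA: "cdf (\<nu> n) x = esd (A (Suc n) w) x" for n x
      proof -
        have "distr (\<nu> n) borel (\<lambda>x. x) = \<nu> n"
          unfolding \<nu>_def spectral_measure_def by (simp add: distr_id2)
        then show ?thesis
          using cdf_distr_spectral_measure[of "A (Suc n) w" "Suc n" "\<lambda>x. x" x] A[of "Suc n" w] elim
          by (simp add: \<nu>_def esd_def)
      qed
      have esdB: "cdf (distr (\<nu> n) borel g) x = esd (B (Suc n) w) x" for n x
      proof -
        have "{#e \<in># proots (char_poly (B (Suc n) w)). Re e \<le> x#}
          = image_mset h {#e \<in># proots (char_poly (A (Suc n) w)). Re (h e) \<le> x#}"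
          using elim by (simp add: roots filter_mset_image_mset)
        also have "{#e \<in># proots (char_poly (A (Suc n) w)). Re (h e) \<le> x#}
          = {#e \<in># proots (char_poly (A (Suc n) w)). g (Re e) \<le> x#}"
          using h_root[of "Suc n" w] elim by (intro filter_mset_cong) auto
        finally show ?thesis
          using cdf_distr_spectral_measure[of "A (Suc n) w" "Suc n" g x] A[of "Suc n" w] carrier[of "Suc n" w] elim
          by (simp add: \<nu>_def esd_def)
      qed
      have "weak_conv_m \<nu> \<mu>"
        using elim unfolding weak_conv_m_def weak_conv_def esdA
        by (auto intro: LIMSEQ_Suc)
      moreover have "real_distribution (\<nu> n)" for n
        unfolding \<nu>_def by (rule real_distribution_spectral_measure)
      ultimately have "weak_conv_m (\<lambda>n. distr (\<nu> n) borel g) (distr \<mu> borel g)"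
        using \<mu>.real_distribution_axioms g null by (intro weak_conv_m_distr)
      then show ?case
        unfolding weak_conv_m_def weak_conv_def esdB
        by (auto intro: LIMSEQ_imp_Suc)
    qed
  qed
  ultimately show ?thesis
    unfolding esd_converges_def by simp
qed

lemma esd_converges_affine:
  assumes conv: "esd_converges P A \<mu>"
    and B: "\<And>N w. N \<ge> 1 \<Longrightarrow> w \<in> space P \<Longrightarrow>
      B N w = complex_of_real a \<cdot>\<^sub>m A N w + complex_of_real b \<cdot>\<^sub>m 1\<^sub>m N"
  shows "esd_converges P B (distr \<mu> borel (\<lambda>x. a * x + b))"
proof (rule esd_converges_transform[OF conv, where h = "\<lambda>e. of_real a * e + of_real b"])
  from conv have A: "A N w \<in> carrier_mat N N" if "N \<ge> 1" "w \<in> space P" for N w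
    using that unfolding esd_converges_def random_matrices_def by auto
  show "B N w \<in> carrier_mat N N" if "N \<ge> 1" "w \<in> space P" for N w
    using A[OF that] B[OF that] by simp
  show "proots (char_poly (B N w)) = image_mset (\<lambda>e. of_real a * e + of_real b) (proots (char_poly (A N w)))"
    if "N \<ge> 1" "w \<in> space P" for N w
    using A[OF that] B[OF that] by (simp add: proots_char_poly_affine)
  fix N i j :: nat assume N: "N \<ge> 1" and ij: "i < N" "j < N"
  have [measurable]: "(\<lambda>w. A N w $$ (i, j)) \<in> borel_measurable P"
    using conv N ij unfolding esd_converges_def random_matrices_def by auto
  have "B N w $$ (i, j) = of_real a * A N w $$ (i, j) + of_real b * (if i = j then 1 else 0)"
    if "w \<in> space P" for w
    using A[OF N that] B[OF N that] ij by simp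
  then show "(\<lambda>w. B N w $$ (i, j)) \<in> borel_measurable P"
    by (subst measurable_cong) auto
qed auto

lemma mat_inverse_invertible:
  fixes A :: "'a :: field mat"
  assumes A: "A \<in> carrier_mat n n" and inv: "invertible_mat A"
  defines "B \<equiv> the (mat_inverse A)"
  shows "B \<in> carrier_mat n n" "A * B = 1\<^sub>m n" "B * A = 1\<^sub>m n"
proof -
  obtain C where C: "A * C = 1\<^sub>m (dim_row A)" "C * A = 1\<^sub>m (dim_row C)"
    using inv unfolding invertible_mat_def inverts_mat_def by blast
  \<comment> \<open>\<open>invertible_mat\<close> leaves the size of the inverse open; comparing
    column counts in the two products shows that it is square of size n. Then \<open>A\<close> is a
    unit of the matrix ring, which excludes the result \<open>None\<close>.\<close>
  have "dim_col C = n"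
    using arg_cong[OF C(1), of dim_col] A by simp
  moreover have "dim_row C = n"
    using arg_cong[OF C(2), of dim_col] A by simp
  ultimately have "C \<in> carrier_mat n n"
    by auto
  then have "A \<in> Units (ring_mat TYPE('a) n n)"
    using A C by (auto simp: Units_def ring_mat_simps)
  then obtain B' where "mat_inverse A = Some B'"
    using mat_inverse(1)[OF A, where b = n] by (cases "mat_inverse A") auto
  then show "B \<in> carrier_mat n n" "A * B = 1\<^sub>m n" "B * A = 1\<^sub>m n"
    using mat_inverse(2)[OF A] by (auto simp: B_def)
qed

lemma esd_converges_inverse:
  assumes conv: "esd_converges P A \<mu>" and atom: "measure \<mu> {0} = 0"
    and inv: "\<And>N w. N \<ge> 1 \<Longrightarrow> w \<in> space P \<Longrightarrow> invertible_mat (A N w)"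
  shows "esd_converges P (\<lambda>N w. the (mat_inverse (A N w))) (distr \<mu> borel inverse)"
proof (rule esd_converges_transform[OF conv, where h = inverse])
  interpret \<mu>: real_distribution \<mu>
    using conv by (simp add: esd_converges_def)
  from conv have A: "A N w \<in> carrier_mat N N" if "N \<ge> 1" "w \<in> space P" for N w
    using that unfolding esd_converges_def random_matrices_def by auto
  note B = mat_inverse_invertible[OF A inv]
  \<comment> \<open>The total function \<open>inverse\<close> can jump only at 0, and the limit
    gives this point no mass.\<close>
  have "{x. \<not> isCont inverse x} \<subseteq> {0 :: real}"
    by (auto intro: continuous_intros)
  then have "emeasure \<mu> {x. \<not> isCont inverse x} \<le> emeasure \<mu> {0}"
    by (intro emeasure_mono) auto
  then show "emeasure \<mu> {x. \<not> isCont inverse x} = 0"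
    using atom by (simp add: \<mu>.emeasure_eq_measure)
  show "the (mat_inverse (A N w)) \<in> carrier_mat N N" if "N \<ge> 1" "w \<in> space P" for N w
    using B(1) that by blast
  show "proots (char_poly (the (mat_inverse (A N w)))) = image_mset inverse (proots (char_poly (A N w)))"
    if "N \<ge> 1" "w \<in> space P" for N w
    using A B that by (intro proots_char_poly_inverse) auto
  fix N i j :: nat assume N: "N \<ge> 1" and ij: "i < N" "j < N"
  show "(\<lambda>w. the (mat_inverse (A N w)) $$ (i, j)) \<in> borel_measurable P"
  proof (rule borel_measurable_inverse_mat_entry[OF A[OF N] B(1)[OF N _ N] B(2)[OF N _ N] _ ij])
    show "(\<lambda>w. A N w $$ (k, l)) \<in> borel_measurable P" if "k < N" "l < N" for k l
      using conv N that unfolding esd_converges_def random_matrices_def by auto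
  qed
qed auto

theorem corollary5p7:
  fixes P :: "'w measure"
    and A :: "nat \<Rightarrow> 'w \<Rightarrow> complex mat"
    and \<mu> :: "real measure"
    and \<alpha> :: real
  assumes "prob_space P"
    and "esd_converges P A \<mu>"
    and "algebraic_distribution \<mu>"
  shows "(measure \<mu> {0} = 0 \<and> (\<forall>N\<ge>1. \<forall>w\<in>space P. invertible_mat (A N w)) \<longrightarrow>
           (\<exists>\<nu>. esd_converges P (\<lambda>N w. the (mat_inverse (A N w))) \<nu> \<and> algebraic_distribution \<nu>))
    \<and> (\<exists>\<nu>. esd_converges P (\<lambda>N w. complex_of_real \<alpha> \<cdot>\<^sub>m A N w) \<nu> \<and> algebraic_distribution \<nu>)
    \<and> (\<exists>\<nu>. esd_converges P (\<lambda>N w. A N w + complex_of_real \<alpha> \<cdot>\<^sub>m 1\<^sub>m N) \<nu> \<and> algebraic_distribution \<nu>)"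
proof (intro conjI impI)
  have \<mu>: "real_distribution \<mu>"
    using assms(2) by (simp add: esd_converges_def)
  have A: "A N w \<in> carrier_mat N N" if "N \<ge> 1" "w \<in> space P" for N w
    using assms(2) that unfolding esd_converges_def random_matrices_def by auto
  show "\<exists>\<nu>. esd_converges P (\<lambda>N w. the (mat_inverse (A N w))) \<nu> \<and> algebraic_distribution \<nu>"
    if "measure \<mu> {0} = 0 \<and> (\<forall>N\<ge>1. \<forall>w\<in>space P. invertible_mat (A N w))"
  proof (intro exI conjI)
    show "esd_converges P (\<lambda>N w. the (mat_inverse (A N w))) (distr \<mu> borel inverse)"
      using assms(2) that by (intro esd_converges_inverse) auto
    show "algebraic_distribution (distr \<mu> borel inverse)"
      using \<mu> assms(3) that by (intro algebraic_distribution_inverse) auto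
  qed
  \<comment> \<open>Scaling is the case \<open>b = 0\<close> and translation the case
    \<open>a = 1\<close>. The equation for \<open>B\<close> is required only where
    \<open>A N w\<close> is known to have size N, since the matrix sums below depend on the
    dimensions.\<close>
  have affine: "\<exists>\<nu>. esd_converges P B \<nu> \<and> algebraic_distribution \<nu>"
    if "\<And>N w. N \<ge> 1 \<Longrightarrow> w \<in> space P \<Longrightarrow>
      B N w = complex_of_real a \<cdot>\<^sub>m A N w + complex_of_real b \<cdot>\<^sub>m 1\<^sub>m N" for B a b
    using esd_converges_affine[OF assms(2) that] algebraic_distribution_affine[OF \<mu> assms(3)] by blast
  show "\<exists>\<nu>. esd_converges P (\<lambda>N w. complex_of_real \<alpha> \<cdot>\<^sub>m A N w) \<nu> \<and> algebraic_distribution \<nu>"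
  proof (rule affine)
    show "complex_of_real \<alpha> \<cdot>\<^sub>m A N w = complex_of_real \<alpha> \<cdot>\<^sub>m A N w + complex_of_real 0 \<cdot>\<^sub>m 1\<^sub>m N"
      if "N \<ge> 1" "w \<in> space P" for N w
      using A[OF that] by (intro eq_matI) auto
  qed
  show "\<exists>\<nu>. esd_converges P (\<lambda>N w. A N w + complex_of_real \<alpha> \<cdot>\<^sub>m 1\<^sub>m N) \<nu> \<and> algebraic_distribution \<nu>"
  proof (rule affine)
    show "A N w + complex_of_real \<alpha> \<cdot>\<^sub>m 1\<^sub>m N = complex_of_real 1 \<cdot>\<^sub>m A N w + complex_of_real \<alpha> \<cdot>\<^sub>m 1\<^sub>m N"
      if "N \<ge> 1" "w \<in> space P" for N w
      using A[OF that] by (intro eq_matI) auto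
  qed
qed

end
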